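(* Let $\delta>0$ and let $\Gamma := \{ M \in \mathrm{Sym}(n) : F(M) \geq (n-2)\frac{\pi}{2}+\delta \}$. Then there exists $A=A(\delta)$ such that the operator $$G = -e^{-AF}$$ is elliptic and concave on $\Gamma$.
   Context: $\mathrm{Sym}(n)$ is the space of real symmetric $n\times n$ matrices, and for $M\in\mathrm{Sym}(n)$ with eigenvalues $\lambda_1,\dots,\lambda_n$, $F(M)=\sum_{i=1}^n\arctan\lambda_i$. Elliptic means that the matrix of first derivatives $\left(\frac{\partial G}{\partial M_{ij}}(M)\right)$ is positive definite at each $M\in\Gamma$. *)

theory Defs
  imports "Jordan_Normal_Form.Char_Poly"
begin

definition Sym :: "nat \<Rightarrow> real mat set" where
  "Sym n = {M \<in> carrier_mat n n. transpose_mat M = M}"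

(* proots yields the roots of a polynomial as a multiset, so eigenvalues are summed with
   multiplicity; for M in Sym n all n roots of char_poly M are real. *)
definition phase :: "real mat \<Rightarrow> real" where
  "phase M = (\<Sum>x\<in>#proots (char_poly M). arctan x)"

definition positive_definite :: "nat \<Rightarrow> real mat \<Rightarrow> bool" where
  "positive_definite n P \<longleftrightarrow>
     P \<in> Sym n \<and> (\<forall>v\<in>carrier_vec n. v \<noteq> 0\<^sub>v n \<longrightarrow> v \<bullet> (P *\<^sub>v v) > 0)"

(* The matrix of first derivatives of a function G on Sym n at M.  The entries M(i,j) and M(j,i)
   are not independent there; the usual convention takes the symmetric matrix P such that the
   derivative of G at M in every symmetric direction H is the sum of all P(i,j) * H(i,j).
   These conditions determine P: with H = (E(i,j) + E(j,i)) / 2 the derivative is P(i,j). *)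
definition has_derivative_matrix ::
  "nat \<Rightarrow> (real mat \<Rightarrow> real) \<Rightarrow> real mat \<Rightarrow> real mat \<Rightarrow> bool" where
  "has_derivative_matrix n G P M \<longleftrightarrow>
     P \<in> Sym n \<and>
     (\<forall>H\<in>Sym n. ((\<lambda>t. G (M + t \<cdot>\<^sub>m H)) has_real_derivative
        (\<Sum>i<n. \<Sum>j<n. P $$ (i, j) * H $$ (i, j))) (at 0))"

definition elliptic_on :: "nat \<Rightarrow> real mat set \<Rightarrow> (real mat \<Rightarrow> real) \<Rightarrow> bool" where
  "elliptic_on n \<Gamma> G \<longleftrightarrow>
     (\<forall>M\<in>\<Gamma>. \<exists>P. has_derivative_matrix n G P M \<and> positive_definite n P)"

(* The type of matrices of arbitrary size is not a real_vector type, so concave_on does not apply.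
   As there, concavity on a set includes convexity of the set. *)
definition mat_concave_on :: "real mat set \<Rightarrow> (real mat \<Rightarrow> real) \<Rightarrow> bool" where
  "mat_concave_on \<Gamma> G \<longleftrightarrow>
     (\<forall>M\<in>\<Gamma>. \<forall>N\<in>\<Gamma>. \<forall>t\<in>{0..1}.
        (1 - t) \<cdot>\<^sub>m M + t \<cdot>\<^sub>m N \<in> \<Gamma> \<and>
        G ((1 - t) \<cdot>\<^sub>m M + t \<cdot>\<^sub>m N) \<ge> (1 - t) * G M + t * G N)"

definition phase_superlevel :: "nat \<Rightarrow> real \<Rightarrow> real mat set" where
  "phase_superlevel n \<delta> = {M \<in> Sym n. phase M \<ge> (real n - 2) * (pi / 2) + \<delta>}"

end

theory Submission
  imports Defs "HOL-Analysis.Convex"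
begin

text \<open>
The Hessian of the phase is never computed. Let \<open>\<theta> x = \<pi> / 2 - arctan x\<close>, with values in \<open>(0, \<pi>)\<close>,
and let \<open>T M\<close> be the sum of the \<open>\<theta> \<lambda>\<close> over the eigenvalues \<open>\<lambda>\<close> of \<open>M\<close>, so that the phase of \<open>M\<close>
is \<open>n \<pi> / 2 - T M\<close> and the superlevel set is given by \<open>T M \<le> \<pi> - \<delta>\<close>. The key is that the function
\<open>cot (T M)\<close> is concave on the set \<open>T M < \<pi>\<close>, and that this set is convex.

For diagonal matrices this follows from the addition theorem \<open>cot (\<alpha> + \<beta>) = (x y - 1) / (x + y)\<close> with
\<open>x = cot \<alpha>\<close>, \<open>y = cot \<beta>\<close>: the right-hand side is concave and increasing in both variables where
\<open>x + y > 0\<close>, and adding one angle at a time preserves concavity. In the form of a tangent inequality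
this is \<open>cot_sum_coangle_tangent\<close>. For symmetric matrices, the diagonal of \<open>M\<close> in any orthonormal basis
is the image of its eigenvalues under a doubly stochastic matrix. A linear functional on such matrices
is extremal at permutations (\<open>doubly_stochastic_rearrangement\<close>), and \<open>T\<close> is symmetric in the
eigenvalues; therefore the tangent inequality passes to the diagonal (\<open>cot_cophase_tangent\<close>). Using it
in an eigenbasis of a convex combination yields \<open>cot_cophase_concave\<close>.

Where \<open>T M < \<pi>\<close>, the phase is \<open>(n - 1) \<pi> / 2 + arctan (cot (T M))\<close>. Hence the general case reduces to
\<open>n = 1\<close>: the function \<open>- exp (- A arctan y)\<close> is increasing, and it is concave for \<open>y \<ge> - A / 2\<close>. On the
superlevel set \<open>y = cot (T M) \<ge> - cot \<delta>\<close>, so that any \<open>A \<ge> 2 \<bar>cot \<delta>\<bar>\<close> gives concavity, whatever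
\<open>n\<close> is.

Ellipticity holds because the derivative of the phase at \<open>M\<close> is the inverse of \<open>1 + M\<^sup>2\<close>. That the
derivative exists is obtained by comparing the spectral decompositions of \<open>M\<close> and of a
nearby matrix (\<open>phase_linearization_error\<close>).
\<close>

section \<open>Concavity of the cotangent of a sum of angles\<close>

text \<open>This is the inverse cotangent with values in \<open>(0, \<pi>)\<close>, the angle complementary to the arctangent.\<close>

definition coangle :: "real \<Rightarrow> real" where
  "coangle x = pi / 2 - arctan x"

lemma coangle_bounds: "0 < coangle x" "coangle x < pi"
  using arctan_bounded[of x] by (auto simp: coangle_def)

lemma cot_coangle [simp]: "cot (coangle x) = x"
  using tan_arctan[of x] by (simp add: coangle_def cot_def cos_diff sin_diff tan_def)

lemma cot_add:
  fixes x y :: real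
  assumes "sin x \<noteq> 0" "sin y \<noteq> 0"
  shows "cot (x + y) = (cot x * cot y - 1) / (cot x + cot y)"
proof -
  have "cot x * cot y - 1 = cos (x + y) / (sin x * sin y)"
    using assms by (simp add: cot_def cos_add field_simps)
  moreover have "cot x + cot y = sin (x + y) / (sin x * sin y)"
    using assms by (simp add: cot_def sin_add field_simps)
  ultimately show ?thesis using assms by (simp add: cot_def)
qed

lemma cot_add_pos:
  fixes x y :: real
  assumes "0 < x" "0 < y" "x + y < pi"
  shows "cot x + cot y > 0"
proof -
  have p: "sin x > 0" "sin y > 0" "sin (x + y) > 0" using assms by (auto intro!: sin_gt_zero)
  then have "cot x + cot y = sin (x + y) / (sin x * sin y)"
    by (simp add: cot_def sin_add field_simps)
  then show ?thesis using p by simp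
qed

text \<open>The function \<open>f x y = (x y - 1) / (x + y)\<close> expresses \<open>cot (\<alpha> + \<beta>)\<close> through \<open>x = cot \<alpha>\<close> and
\<open>y = cot \<beta>\<close>. It is concave where \<open>x + y > 0\<close>, because
\<open>f x y = (x + y) / 4 - (x - y)\<^sup>2 / (4 (x + y)) - 1 / (x + y)\<close>, and the inequality puts its graph below
the tangent planes. Since \<open>1 + f\<^sup>2 = (1 + x\<^sup>2) (1 + y\<^sup>2) / (x + y)\<^sup>2\<close>, the partial derivatives are
\<open>(1 + f\<^sup>2) / (1 + x\<^sup>2)\<close> and \<open>(1 + f\<^sup>2) / (1 + y\<^sup>2)\<close>; in this form they compose without effort when
further angles are added.\<close>

lemma cot_addition_tangent:
  fixes x y x' y' :: real
  assumes "x + y > 0" "x' + y' > 0"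
  defines "f \<equiv> (x * y - 1) / (x + y)"
  shows "(x' * y' - 1) / (x' + y') \<le> f + (1 + f\<^sup>2) * ((x' - x) / (1 + x\<^sup>2) + (y' - y) / (1 + y\<^sup>2))"
proof -
  have nz: "1 + x\<^sup>2 > 0" "1 + y\<^sup>2 > 0" by (auto intro: add_pos_nonneg)
  have sq: "1 + f\<^sup>2 = (1 + x\<^sup>2) * (1 + y\<^sup>2) / (x + y)\<^sup>2"
    using assms by (simp add: f_def divide_simps) (simp add: power2_eq_square algebra_simps)
  have "(1 + f\<^sup>2) * ((x' - x) / (1 + x\<^sup>2) + (y' - y) / (1 + y\<^sup>2))
      = ((1 + y\<^sup>2) * (x' - x) + (1 + x\<^sup>2) * (y' - y)) / (x + y)\<^sup>2"
  proof -
    have "u * v / s * (a / u + b / v) = (v * a + u * b) / s" if "u > 0" "v > 0" for s a b u v :: real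
      using that by (cases "s = 0") (simp_all add: field_simps)
    from this[OF nz] show ?thesis unfolding sq .
  qed
  then have "f + (1 + f\<^sup>2) * ((x' - x) / (1 + x\<^sup>2) + (y' - y) / (1 + y\<^sup>2)) - (x' * y' - 1) / (x' + y')
      = ((x + y) * (x' + y') * (x * y - 1) + (x' + y') * ((1 + y\<^sup>2) * (x' - x) + (1 + x\<^sup>2) * (y' - y))
          - (x + y)\<^sup>2 * (x' * y' - 1)) / ((x + y)\<^sup>2 * (x' + y'))"
    using assms by (simp add: f_def divide_simps) (simp add: power2_eq_square algebra_simps)
  also have "(x + y) * (x' + y') * (x * y - 1) + (x' + y') * ((1 + y\<^sup>2) * (x' - x) + (1 + x\<^sup>2) * (y' - y))
          - (x + y)\<^sup>2 * (x' * y' - 1) = ((x' * y - x * y')\<^sup>2 + (x' + y' - x - y)\<^sup>2)"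
    by (simp add: power2_eq_square algebra_simps)
  also have "\<dots> / ((x + y)\<^sup>2 * (x' + y')) \<ge> 0"
    using assms by simp
  finally show "(x' * y' - 1) / (x' + y') \<le> f + (1 + f\<^sup>2) * ((x' - x) / (1 + x\<^sup>2) + (y' - y) / (1 + y\<^sup>2))"
    by simp
qed

text \<open>Angles are added one at a time. The tangent inequality for two angles bounds the effect of the new
angle and of the cotangent of the old sum; the latter enters with a nonnegative coefficient, so the
induction hypothesis may be inserted. Its factor \<open>1 + cot\<^sup>2 Y\<close> cancels the denominator.\<close>

lemma cot_sum_coangle_tangent:
  assumes "finite I" "I \<noteq> {}"
    and "(\<Sum>i\<in>I. coangle (x i)) < pi" "(\<Sum>i\<in>I. coangle (y i)) < pi"
  shows "cot (\<Sum>i\<in>I. coangle (x i)) \<le> cot (\<Sum>i\<in>I. coangle (y i))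
      + (1 + (cot (\<Sum>i\<in>I. coangle (y i)))\<^sup>2) * (\<Sum>i\<in>I. (x i - y i) / (1 + (y i)\<^sup>2))"
  using assms
proof (induction I rule: finite_ne_induct)
  case (singleton i)
  have "1 + (y i)\<^sup>2 > 0" by (auto intro: add_pos_nonneg)
  then show ?case by simp
next
  case (insert i I)
  define X where "X = (\<Sum>i\<in>I. coangle (x i))"
  define Y where "Y = (\<Sum>i\<in>I. coangle (y i))"
  define L where "L = (\<Sum>i\<in>I. (x i - y i) / (1 + (y i)\<^sup>2))"
  have pos: "X > 0" "Y > 0"
    unfolding X_def Y_def using insert.hyps coangle_bounds by (auto intro!: sum_pos)
  have lt: "coangle (x i) + X < pi" "coangle (y i) + Y < pi"
    using insert by (auto simp: X_def Y_def)
  then have XY: "X < pi" "Y < pi" using coangle_bounds[of "x i"] coangle_bounds[of "y i"] by linarith+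
  have IH: "cot X \<le> cot Y + (1 + (cot Y)\<^sup>2) * L"
    using insert.IH XY by (simp add: X_def Y_def L_def)
  have sin: "sin (coangle z) \<noteq> 0" for z
    using coangle_bounds[of z] sin_gt_zero[of "coangle z"] by simp
  have sinXY: "sin X \<noteq> 0" "sin Y \<noteq> 0"
    using sin_gt_zero[of X] sin_gt_zero[of Y] pos XY by auto
  have cx: "cot (coangle (x i) + X) = (x i * cot X - 1) / (x i + cot X)"
    using cot_add[OF sin sinXY(1), of "x i"] by simp
  have cy: "cot (coangle (y i) + Y) = (y i * cot Y - 1) / (y i + cot Y)"
    using cot_add[OF sin sinXY(2), of "y i"] by simp
  have p: "y i + cot Y > 0" "x i + cot X > 0"
    using cot_add_pos[of "coangle (x i)" X] cot_add_pos[of "coangle (y i)" Y] pos lt coangle_bounds by auto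
  define q where "q = 1 + (cot (coangle (y i) + Y))\<^sup>2"
  have q0: "q \<ge> 0" by (simp add: q_def)
  have nz: "1 + (cot Y)\<^sup>2 > 0" by (auto intro: add_pos_nonneg)
  have "cot (coangle (x i) + X) \<le> cot (coangle (y i) + Y)
      + q * ((x i - y i) / (1 + (y i)\<^sup>2) + (cot X - cot Y) / (1 + (cot Y)\<^sup>2))"
    unfolding q_def cx cy by (rule cot_addition_tangent[OF p])
  also have "\<dots> \<le> cot (coangle (y i) + Y) + q * ((x i - y i) / (1 + (y i)\<^sup>2) + L)"
  proof (intro add_left_mono mult_left_mono q0)
    show "(cot X - cot Y) / (1 + (cot Y)\<^sup>2) \<le> L"
      using IH nz by (simp add: pos_divide_le_eq mult.commute)
  qed
  finally show ?case using insert.hyps by (simp add: X_def Y_def L_def q_def)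
qed

section \<open>Minimizing over doubly stochastic matrices\<close>

text \<open>A linear functional on the doubly stochastic matrices is minimal at a permutation matrix. To find a
permutation, let \<open>a\<close> be largest at \<open>k\<close> and \<open>b\<close> smallest at \<open>l\<close>. Moving mass from the positions
\<open>(i, l)\<close> and \<open>(k, j)\<close> to \<open>(i, j)\<close> and \<open>(k, l)\<close> changes the value by a nonnegative multiple of
\<open>(a i - a k) (b j - b l) \<le> 0\<close>. Once all the mass of row \<open>k\<close> and of column \<open>l\<close> sits at \<open>(k, l)\<close>,
this row and this column are matched with each other and removed.\<close>

lemma doubly_stochastic_rearrangement:
  fixes a :: "'i \<Rightarrow> real" and b :: "'j \<Rightarrow> real"
  assumes "finite I" "finite J"
    and "\<And>i j. i \<in> I \<Longrightarrow> j \<in> J \<Longrightarrow> P i j \<ge> 0"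
    and "\<And>i. i \<in> I \<Longrightarrow> (\<Sum>j\<in>J. P i j) = 1"
    and "\<And>j. j \<in> J \<Longrightarrow> (\<Sum>i\<in>I. P i j) = 1"
  shows "\<exists>f. bij_betw f I J \<and> (\<Sum>i\<in>I. a i * b (f i)) \<le> (\<Sum>i\<in>I. \<Sum>j\<in>J. P i j * (a i * b j))"
  using assms
proof (induction "card I" arbitrary: I J P)
  case 0
  then have "I = {}" by simp
  moreover have "J = {}" using 0 by (auto simp: \<open>I = {}\<close>)
  ultimately show ?case by (simp add: bij_betw_def)
next
  case (Suc n)
  have I: "I \<noteq> {}" using Suc.hyps(2) by auto
  then have J: "J \<noteq> {}" using Suc.prems(4) by fastforce
  obtain k where k: "k \<in> I" "\<And>i. i \<in> I \<Longrightarrow> a i \<le> a k"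
    using arg_min_if_finite[OF Suc.prems(1) I, of "\<lambda>i. - a i"] by (metis leI neg_less_iff_less)
  obtain l where l: "l \<in> J" "\<And>j. j \<in> J \<Longrightarrow> b l \<le> b j"
    using arg_min_if_finite[OF Suc.prems(2) J, of b] by (metis leI)
  define I' where "I' = I - {k}"
  define J' where "J' = J - {l}"
  have fin: "finite I'" "finite J'" using Suc.prems by (auto simp: I'_def J'_def)
  have sumI: "(\<Sum>i\<in>I. g i) = g k + (\<Sum>i\<in>I'. g i)" for g :: "'i \<Rightarrow> real"
    unfolding I'_def by (rule sum.remove) (use Suc.prems k in auto)
  have sumJ: "(\<Sum>j\<in>J. g j) = g l + (\<Sum>j\<in>J'. g j)" for g :: "'j \<Rightarrow> real"
    unfolding J'_def by (rule sum.remove) (use Suc.prems l in auto)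
  define c where "c = 1 - P k l"
  have row: "(\<Sum>j\<in>J'. P k j) = c" using Suc.prems(4)[OF k(1)] sumJ[of "P k"] by (simp add: c_def)
  have col: "(\<Sum>i\<in>I'. P i l) = c" using Suc.prems(5)[OF l(1)] sumI[of "\<lambda>i. P i l"] by (simp add: c_def)
  have c0: "c \<ge> 0" unfolding row[symmetric] using Suc.prems(3) k by (intro sum_nonneg) (auto simp: J'_def)
  have col0: "P i l = 0" if "c = 0" "i \<in> I'" for i
    by (rule sum_nonneg_0[OF fin(1) _ col[unfolded that(1)] that(2)]) (use Suc.prems(3) l in \<open>auto simp: I'_def\<close>)
  have row0: "P k j = 0" if "c = 0" "j \<in> J'" for j
    by (rule sum_nonneg_0[OF fin(2) _ row[unfolded that(1)] that(2)]) (use Suc.prems(3) k in \<open>auto simp: J'_def\<close>)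
  \<comment> \<open>Row k and column l each carry the mass c outside their corner; it is redistributed over the
    remaining block as a product. If c = 0, the block is unchanged, as division by zero gives 0.\<close>
  define Q where "Q i j = P i j + P i l * P k j / c" for i j
  have "\<exists>f. bij_betw f I' J' \<and> (\<Sum>i\<in>I'. a i * b (f i)) \<le> (\<Sum>i\<in>I'. \<Sum>j\<in>J'. Q i j * (a i * b j))"
  proof (rule Suc.hyps(1))
    show "n = card I'" using Suc.hyps(2) k by (simp add: I'_def)
    show "Q i j \<ge> 0" if "i \<in> I'" "j \<in> J'" for i j
      using that Suc.prems(3) k l c0 by (auto simp: Q_def I'_def J'_def)
    show "(\<Sum>j\<in>J'. Q i j) = 1" if "i \<in> I'" for i
    proof -
      have "(\<Sum>j\<in>J'. Q i j) = (\<Sum>j\<in>J'. P i j) + P i l * c / c"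
        by (simp add: Q_def sum.distrib row flip: sum_distrib_left sum_divide_distrib)
      also have "P i l * c / c = P i l" using col0[OF _ that] by auto
      finally show ?thesis using Suc.prems(4)[of i] that sumJ[of "P i"] by (simp add: I'_def)
    qed
    show "(\<Sum>i\<in>I'. Q i j) = 1" if "j \<in> J'" for j
    proof -
      have "(\<Sum>i\<in>I'. Q i j) = (\<Sum>i\<in>I'. P i j) + c * P k j / c"
        by (simp add: Q_def sum.distrib col flip: sum_distrib_right sum_divide_distrib)
      also have "c * P k j / c = P k j" using row0[OF _ that] by auto
      finally show ?thesis using Suc.prems(5)[of j] that sumI[of "\<lambda>i. P i j"] by (simp add: J'_def)
    qed
  qed (use fin in auto)
  then obtain f where f: "bij_betw f I' J'"
    "(\<Sum>i\<in>I'. a i * b (f i)) \<le> (\<Sum>i\<in>I'. \<Sum>j\<in>J'. Q i j * (a i * b j))" by blast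
  define g where "g = f(k := l)"
  have g: "bij_betw g I J"
  proof -
    have "bij_betw g I' J'" using f(1) by (rule bij_betw_cong[THEN iffD1, rotated]) (auto simp: g_def I'_def)
    then have "bij_betw g (I' \<union> {k}) (J' \<union> {l})"
      using notIn_Un_bij_betw[of k I' g J'] by (auto simp: g_def I'_def J'_def)
    then show ?thesis using k l by (simp add: I'_def J'_def insert_absorb)
  qed
  have swap: "P i l * P k j / c * (a i * b j)
      \<le> P i l * P k j / c * (a i * b l + a k * b j - a k * b l)" if "i \<in> I'" "j \<in> J'" for i j
  proof (rule mult_left_mono)
    have "(a k - a i) * (b j - b l) \<ge> 0" using k l that by (simp add: I'_def J'_def)
    then show "a i * b j \<le> a i * b l + a k * b j - a k * b l" by (simp add: algebra_simps)
    show "0 \<le> P i l * P k j / c" using that Suc.prems(3) k l c0 by (auto simp: I'_def J'_def)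
  qed
  have "(\<Sum>i\<in>I'. \<Sum>j\<in>J'. P i l * P k j / c * (a i * b j))
      \<le> (\<Sum>i\<in>I'. \<Sum>j\<in>J'. P i l * P k j / c * (a i * b l + a k * b j - a k * b l))"
    by (intro sum_mono swap)
  also have "\<dots> = (\<Sum>i\<in>I'. \<Sum>j\<in>J'. (P i l * (a i * b l) / c) * P k j)
      + (\<Sum>i\<in>I'. \<Sum>j\<in>J'. P i l * (P k j * (a k * b j) / c))
      - (\<Sum>i\<in>I'. \<Sum>j\<in>J'. P i l * (P k j * (a k * b l) / c))"
    unfolding sum.distrib[symmetric] sum_subtractf[symmetric]
    by (intro sum.cong refl) (simp add: algebra_simps add_divide_distrib diff_divide_distrib)
  also have "(\<Sum>i\<in>I'. \<Sum>j\<in>J'. (P i l * (a i * b l) / c) * P k j) = (\<Sum>i\<in>I'. P i l * (a i * b l))"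
    unfolding sum_distrib_left[symmetric] row using col0 by (intro sum.cong refl) auto
  also have "(\<Sum>i\<in>I'. \<Sum>j\<in>J'. P i l * (P k j * (a k * b j) / c)) = (\<Sum>j\<in>J'. P k j * (a k * b j))"
    unfolding sum_distrib_left[symmetric] sum_distrib_right[symmetric] col
    unfolding sum_distrib_left using row0 by (intro sum.cong refl) auto
  also have "(\<Sum>i\<in>I'. \<Sum>j\<in>J'. P i l * (P k j * (a k * b l) / c)) = c * (a k * b l)"
    unfolding sum_distrib_left[symmetric] sum_distrib_right[symmetric] col
    unfolding sum_divide_distrib[symmetric] sum_distrib_right[symmetric] row by simp
  finally have ineq: "(\<Sum>i\<in>I'. \<Sum>j\<in>J'. P i l * P k j / c * (a i * b j)) + c * (a k * b l)
      \<le> (\<Sum>i\<in>I'. P i l * (a i * b l)) + (\<Sum>j\<in>J'. P k j * (a k * b j))" by simp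
  have "(\<Sum>i\<in>I. a i * b (g i)) = a k * b l + (\<Sum>i\<in>I'. a i * b (f i))"
    unfolding sumI by (auto simp: g_def I'_def intro!: sum.cong)
  also have "\<dots> \<le> a k * b l + (\<Sum>i\<in>I'. \<Sum>j\<in>J'. Q i j * (a i * b j))" using f(2) by simp
  also have "\<dots> = a k * b l + (\<Sum>i\<in>I'. \<Sum>j\<in>J'. P i j * (a i * b j))
      + (\<Sum>i\<in>I'. \<Sum>j\<in>J'. P i l * P k j / c * (a i * b j))"
    by (simp add: Q_def distrib_right sum.distrib)
  also have "\<dots> \<le> P k l * (a k * b l) + (\<Sum>j\<in>J'. P k j * (a k * b j))
      + ((\<Sum>i\<in>I'. P i l * (a i * b l)) + (\<Sum>i\<in>I'. \<Sum>j\<in>J'. P i j * (a i * b j)))"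
    using ineq by (simp add: c_def algebra_simps)
  also have "\<dots> = (\<Sum>i\<in>I. \<Sum>j\<in>J. P i j * (a i * b j))"
    unfolding sumI sumJ by (simp add: sum.distrib)
  finally show ?case using g by blast
qed

section \<open>The spectral theorem for real symmetric matrices\<close>

lemma symmetric_scalar_prod:
  assumes M: "M \<in> Sym n" and x: "x \<in> carrier_vec n" and y: "y \<in> carrier_vec n"
  shows "x \<bullet> (M *\<^sub>v y) = (M *\<^sub>v x) \<bullet> y"
  using transpose_vec_mult_scalar[of M n n y x] M x y by (simp add: Sym_def)

text \<open>The characteristic polynomial has a complex root \<open>c\<close>, with an eigenvector \<open>x + i y\<close>. Comparing
\<open>x \<bullet> M y\<close> with \<open>M x \<bullet> y\<close> gives \<open>Im c * (x \<bullet> x + y \<bullet> y) = 0\<close>. Hence \<open>c\<close> is real, and \<open>x\<close> and \<open>y\<close>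
satisfy the eigenvector equation separately.\<close>

lemma symmetric_real_eigenvector:
  assumes M: "M \<in> Sym n" and n: "n > 0"
  shows "\<exists>v e. v \<in> carrier_vec n \<and> v \<bullet> v = 1 \<and> M *\<^sub>v v = e \<cdot>\<^sub>v v"
proof -
  have Mc: "M \<in> carrier_mat n n" using M by (simp add: Sym_def)
  define N where "N = map_mat complex_of_real M"
  have N: "N \<in> carrier_mat n n" using Mc by (simp add: N_def)
  have "degree (char_poly N) \<noteq> 0" using degree_monic_char_poly[OF N] n by simp
  then obtain c where "poly (char_poly N) c = 0"
    using fundamental_theorem_of_algebra[of "char_poly N"]
    by (auto simp: constant_degree)
  then have "eigenvalue N c" using eigenvalue_root_char_poly[OF N] by simp
  then obtain z where z: "z \<in> carrier_vec n" "z \<noteq> 0\<^sub>v n" "N *\<^sub>v z = c \<cdot>\<^sub>v z"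
    using N by (auto simp: eigenvalue_def eigenvector_def)
  define x where "x = map_vec Re z"
  define y where "y = map_vec Im z"
  have xy: "x \<in> carrier_vec n" "y \<in> carrier_vec n" using z by (auto simp: x_def y_def)
  have zi: "row N i \<bullet> z = c * z $ i" if "i < n" for i
    using arg_cong[OF z(3), of "\<lambda>v. v $ i"] that z(1) N by simp
  have Mx: "M *\<^sub>v x = Re c \<cdot>\<^sub>v x - Im c \<cdot>\<^sub>v y"
  proof (rule eq_vecI)
    fix i assume "i < dim_vec (Re c \<cdot>\<^sub>v x - Im c \<cdot>\<^sub>v y)"
    then have i: "i < n" using xy by simp
    have "(M *\<^sub>v x) $ i = Re (row N i \<bullet> z)"
      using i z Mc by (simp add: N_def x_def scalar_prod_def)
    also have "\<dots> = (Re c \<cdot>\<^sub>v x - Im c \<cdot>\<^sub>v y) $ i"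
      using zi[OF i] i z by (simp add: x_def y_def)
    finally show "(M *\<^sub>v x) $ i = (Re c \<cdot>\<^sub>v x - Im c \<cdot>\<^sub>v y) $ i" .
  qed (use Mc xy in auto)
  have My: "M *\<^sub>v y = Re c \<cdot>\<^sub>v y + Im c \<cdot>\<^sub>v x"
  proof (rule eq_vecI)
    fix i assume "i < dim_vec (Re c \<cdot>\<^sub>v y + Im c \<cdot>\<^sub>v x)"
    then have i: "i < n" using xy by simp
    have "(M *\<^sub>v y) $ i = Im (row N i \<bullet> z)"
      using i z Mc by (simp add: N_def y_def scalar_prod_def)
    also have "\<dots> = (Re c \<cdot>\<^sub>v y + Im c \<cdot>\<^sub>v x) $ i"
      using zi[OF i] i z by (simp add: x_def y_def)
    finally show "(M *\<^sub>v y) $ i = (Re c \<cdot>\<^sub>v y + Im c \<cdot>\<^sub>v x) $ i" .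
  qed (use Mc xy in auto)
  have nz: "x \<noteq> 0\<^sub>v n \<or> y \<noteq> 0\<^sub>v n"
  proof (rule ccontr)
    assume "\<not> ?thesis"
    then have "z $ i = 0" if "i < n" for i
      using that z(1) by (auto simp: x_def y_def complex_eq_iff vec_eq_iff)
    then show False using z by (auto simp: vec_eq_iff)
  qed
  have nonneg: "u \<bullet> u \<ge> 0" for u :: "real vec"
    by (simp add: scalar_prod_def sum_nonneg)
  have pos: "u \<bullet> u > 0" if "u \<in> carrier_vec n" "u \<noteq> 0\<^sub>v n" for u :: "real vec"
  proof -
    have "u \<bullet> u \<noteq> 0"
      using that by (auto simp: scalar_prod_def sum_nonneg_eq_0_iff vec_eq_iff)
    then show ?thesis using nonneg[of u] by linarith
  qed
  have "x \<bullet> (M *\<^sub>v y) = (M *\<^sub>v x) \<bullet> y"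
    by (rule symmetric_scalar_prod[OF M xy])
  then have "Im c * (x \<bullet> x + y \<bullet> y) = 0"
    using xy unfolding Mx My
    by (simp add: scalar_prod_add_distrib[of _ n] minus_scalar_prod_distrib[of _ n] algebra_simps)
  moreover have "x \<bullet> x + y \<bullet> y > 0"
    using nz pos[OF xy(1)] pos[OF xy(2)] nonneg[of x] nonneg[of y] by linarith
  ultimately have c: "Im c = 0" by simp
  obtain u where u: "u \<in> carrier_vec n" "u \<noteq> 0\<^sub>v n" "M *\<^sub>v u = Re c \<cdot>\<^sub>v u"
  proof (cases "x = 0\<^sub>v n")
    case True
    have "M *\<^sub>v y = Re c \<cdot>\<^sub>v y" using My c xy by (auto simp: vec_eq_iff)
    then show ?thesis using that[of y] nz True xy by blast
  next
    case False
    have "M *\<^sub>v x = Re c \<cdot>\<^sub>v x" using Mx c xy by (auto simp: vec_eq_iff)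
    then show ?thesis using that[of x] False xy by blast
  qed
  define v where "v = (1 / sqrt (u \<bullet> u)) \<cdot>\<^sub>v u"
  have "v \<in> carrier_vec n" using u by (simp add: v_def)
  moreover have "v \<bullet> v = 1" using u pos[OF u(1,2)] by (simp add: v_def)
  moreover have "M *\<^sub>v v = Re c \<cdot>\<^sub>v v"
    using u Mc by (simp add: v_def mult_mat_vec smult_smult_assoc mult.commute)
  ultimately show ?thesis by blast
qed

text \<open>The reflection in the hyperplane orthogonal to \<open>w = v - e\<^sub>0\<close> exchanges the unit vectors \<open>e\<^sub>0\<close> and
\<open>v\<close>, so it is an orthogonal matrix with prescribed first column. If \<open>v = e\<^sub>0\<close>, the formula degenerates
to the identity matrix, as desired.\<close>

lemma Householder_reflection:
  fixes v :: "real vec"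
  assumes v: "v \<in> carrier_vec n" "v \<bullet> v = 1" and n: "n > 0"
  shows "\<exists>R \<in> Sym n. R * R = 1\<^sub>m n \<and> col R 0 = v"
proof -
  define w where "w = v - unit_vec n 0"
  define s where "s = (\<Sum>k<n. w $ k * w $ k)"
  have wi: "w $ i = v $ i - (if i = 0 then 1 else 0)" if "i < n" for i
    using that v n by (simp add: w_def)
  have vv: "(\<Sum>k<n. v $ k * v $ k) = 1"
    using v by (simp add: scalar_prod_def atLeast0LessThan)
  have "s = (\<Sum>k<n. v $ k * v $ k - (if k = 0 then 2 * v $ 0 - 1 else 0))"
    unfolding s_def by (rule sum.cong) (auto simp: wi algebra_simps)
  then have s: "s = 2 - 2 * v $ 0"
    using vv n by (simp add: sum_subtractf)
  have s0: "w $ i = 0" if "s = 0" "i < n" for i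
    using that by (auto simp: s_def sum_nonneg_eq_0_iff)
  define R where "R = mat n n (\<lambda>(i, j). (if i = j then 1 else 0) - 2 / s * (w $ i * w $ j))"
  have "R \<in> Sym n"
    by (auto simp: R_def Sym_def mult.commute)
  moreover have "R * R = 1\<^sub>m n"
  proof (rule eq_matI)
    fix i j assume "i < dim_row (1\<^sub>m n :: real mat)" "j < dim_col (1\<^sub>m n :: real mat)"
    then have ij: "i < n" "j < n" by auto
    have "(R * R) $$ (i, j)
        = (\<Sum>k<n. ((if i = k then 1 else 0) - 2 / s * (w $ i * w $ k))
            * ((if k = j then 1 else 0) - 2 / s * (w $ k * w $ j)))"
      using ij by (simp add: R_def scalar_prod_def atLeast0LessThan)
    also have "\<dots> = (\<Sum>k<n. (if k = i then (if i = j then 1 else 0) - 2 / s * (w $ i * w $ j) else 0)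
            - (if k = j then 2 / s * (w $ i * w $ j) else 0)
            + (4 / s\<^sup>2 * w $ i * w $ j) * (w $ k * w $ k))"
      by (rule sum.cong) (auto simp: algebra_simps power2_eq_square)
    also have "\<dots> = (if i = j then 1 else 0) - 4 / s * (w $ i * w $ j)
            + (4 / s\<^sup>2 * w $ i * w $ j) * s"
      using ij by (simp add: sum.distrib sum_subtractf s_def sum_distrib_left)
    also have "\<dots> = (if i = j then 1 else 0)"
      by (cases "s = 0") (auto simp: power2_eq_square)
    finally show "(R * R) $$ (i, j) = 1\<^sub>m n $$ (i, j)" using ij by simp
  qed (auto simp: R_def)
  moreover have "col R 0 = v"
  proof (rule eq_vecI)
    fix i assume "i < dim_vec v"
    then have i: "i < n" using v by simp
    have "col R 0 $ i = (if i = 0 then 1 else 0) - 2 / s * (w $ i * (v $ 0 - 1))"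
      using i n wi[of 0] by (simp add: R_def)
    also have "\<dots> = (if i = 0 then 1 else 0) + w $ i"
    proof (cases "s = 0")
      case False
      have "v $ 0 - 1 = - s / 2" by (simp add: s field_simps)
      then have "2 / s * (w $ i * (v $ 0 - 1)) = - w $ i" using False by simp
      then show ?thesis by simp
    qed (use s0 i in auto)
    finally show "col R 0 $ i = v $ i" using wi[OF i] by simp
  qed (use v in \<open>simp add: R_def\<close>)
  ultimately show ?thesis by blast
qed

lemma block_diagonal_mult:
  assumes "X \<in> carrier_mat 1 1" "X' \<in> carrier_mat 1 1" "Y \<in> carrier_mat n n" "Y' \<in> carrier_mat n n"
  shows "four_block_mat X (0\<^sub>m 1 n) (0\<^sub>m n 1) Y * four_block_mat X' (0\<^sub>m 1 n) (0\<^sub>m n 1) Y'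
    = four_block_mat (X * X') (0\<^sub>m 1 n) (0\<^sub>m n 1) (Y * Y' :: 'a :: comm_ring_1 mat)"
  using assms mult_four_block_mat[of X 1 1 "0\<^sub>m 1 n" n "0\<^sub>m n 1" n Y X' 1 "0\<^sub>m 1 n" n "0\<^sub>m n 1" Y']
  by simp

text \<open>Conjugation with a reflection that maps \<open>e\<^sub>0\<close> to a unit eigenvector splits off a 1 by 1 block,
and symmetry makes the remainder block diagonal; the induction hypothesis diagonalizes the other block.\<close>

lemma spectral_theorem:
  assumes "M \<in> Sym n"
  shows "\<exists>U d. U \<in> carrier_mat n n \<and> U * transpose_mat U = 1\<^sub>m n \<and> M = U * mat_diag n d * transpose_mat U"
  using assms
proof (induction n arbitrary: M)
  case 0
  then show ?case by (intro exI[of _ "1\<^sub>m 0"]) (auto simp: Sym_def intro!: eq_matI)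
next
  case (Suc n)
  let ?m = "Suc n"
  have Mc: "M \<in> carrier_mat ?m ?m" using Suc.prems by (simp add: Sym_def)
  obtain v :: "real vec" and e where v: "v \<in> carrier_vec ?m" "v \<bullet> v = 1" "M *\<^sub>v v = e \<cdot>\<^sub>v v"
    using symmetric_real_eigenvector[OF Suc.prems] by auto
  obtain R where R: "R \<in> Sym ?m" "R * R = 1\<^sub>m ?m" "col R 0 = v"
    using Householder_reflection[OF v(1,2)] by auto
  have Rc: "R \<in> carrier_mat ?m ?m" and RT: "transpose_mat R = R" using R by (auto simp: Sym_def)
  have MT: "transpose_mat M = M" using Suc.prems by (simp add: Sym_def)
  define B where "B = R * M * R"
  have Bc: "B \<in> carrier_mat ?m ?m" using Rc Mc by (simp add: B_def)
  have BT: "transpose_mat B = B"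
    using Rc Mc by (simp add: B_def transpose_mult[of _ ?m ?m _ ?m] RT MT assoc_mult_mat[of _ ?m ?m _ ?m _ ?m])
  have Bsym: "B $$ (i, j) = B $$ (j, i)" if "i < ?m" "j < ?m" for i j
    using arg_cong[OF BT, of "\<lambda>X. X $$ (i, j)"] that Bc by simp
  have "col B 0 = e \<cdot>\<^sub>v unit_vec ?m 0"
  proof -
    have "col B 0 = (R * M) *\<^sub>v v"
      using Rc Mc R(3) col_mult2[of "R * M" ?m ?m R ?m 0] by (simp add: B_def)
    also have "\<dots> = R *\<^sub>v (M *\<^sub>v v)"
      using Rc Mc v by (simp add: assoc_mult_mat_vec[of _ ?m ?m _ ?m])
    also have "\<dots> = e \<cdot>\<^sub>v (R *\<^sub>v v)"
      using Rc v by (simp add: mult_mat_vec)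
    also have "R *\<^sub>v v = col (R * R) 0"
      using Rc R(3) col_mult2[of R ?m ?m R ?m 0] by simp
    finally show ?thesis by (simp add: R(2))
  qed
  then have B0: "B $$ (i, 0) = (if i = 0 then e else 0)" if "i < ?m" for i
    using arg_cong[of _ _ "\<lambda>x. x $ i"] that Bc by (auto simp: vec_eq_iff)
  define D where "D = mat n n (\<lambda>(i, j). B $$ (Suc i, Suc j))"
  have "D \<in> Sym n" by (auto simp: D_def Sym_def Bsym)
  then obtain V d where V: "V \<in> carrier_mat n n" "V * transpose_mat V = 1\<^sub>m n"
      "D = V * mat_diag n d * transpose_mat V"
    using Suc.IH by blast
  define W where "W = four_block_mat (1\<^sub>m 1) (0\<^sub>m 1 n) (0\<^sub>m n 1) V"
  have Wc: "W \<in> carrier_mat ?m ?m" using V by (simp add: W_def four_block_carrier_mat[of _ 1 1 _ n n, simplified])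
  have WT: "transpose_mat W = four_block_mat (1\<^sub>m 1) (0\<^sub>m 1 n) (0\<^sub>m n 1) (transpose_mat V)"
    unfolding W_def using V by (subst transpose_four_block_mat) auto
  define d' where "d' = case_nat e d"
  have diag: "mat_diag ?m d' = four_block_mat (mat_diag 1 (\<lambda>_. e)) (0\<^sub>m 1 n) (0\<^sub>m n 1) (mat_diag n d)"
    by (rule eq_matI) (auto simp: mat_diag_def d'_def split: nat.splits)
  have BW: "B = W * mat_diag ?m d' * transpose_mat W"
  proof -
    have "W * mat_diag ?m d' * transpose_mat W = four_block_mat (mat_diag 1 (\<lambda>_. e)) (0\<^sub>m 1 n) (0\<^sub>m n 1) D"
      unfolding WT diag V(3) unfolding W_def
      using V(1) mat_diag_dim[of 1 "\<lambda>_. e"] mat_diag_dim[of n d]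
      by (simp add: block_diagonal_mult mult_carrier_mat[of _ n n _ n] left_mult_one_mat[of _ 1 1]
          right_mult_one_mat[of _ 1 1] del: One_nat_def)
    also have "\<dots> = B"
    proof (rule eq_matI)
      fix i j assume "i < dim_row B" "j < dim_col B"
      then have ij: "i < ?m" "j < ?m" using Bc by auto
      then show "four_block_mat (mat_diag 1 (\<lambda>_. e)) (0\<^sub>m 1 n) (0\<^sub>m n 1) D $$ (i, j) = B $$ (i, j)"
        using B0[of i] B0[of j] Bsym[of 0 j] 
        by (cases i; cases j) (auto simp: D_def mat_diag_def)
    qed (use Bc in \<open>auto simp: D_def mat_diag_def\<close>)
    finally show ?thesis by simp
  qed
  have WW: "W * transpose_mat W = 1\<^sub>m ?m"
    unfolding WT unfolding W_def using V
    by (simp add: block_diagonal_mult del: One_nat_def) simp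
  show ?case
  proof (intro exI conjI)
    show "R * W \<in> carrier_mat ?m ?m" using Rc Wc by simp
    have "R * W * transpose_mat (R * W) = R * (W * transpose_mat W) * R"
      using Rc Wc by (simp add: transpose_mult[of _ ?m ?m _ ?m] RT assoc_mult_mat[of _ ?m ?m _ ?m _ ?m])
    then show "R * W * transpose_mat (R * W) = 1\<^sub>m ?m"
      using Rc by (simp add: WW R(2))
    have "R * W * mat_diag ?m d' * transpose_mat (R * W) = R * (W * mat_diag ?m d' * transpose_mat W) * R"
      using Rc Wc mat_diag_dim[of ?m d'] by (simp add: mult_carrier_mat[of _ ?m ?m _ ?m] transpose_mult[of _ ?m ?m _ ?m] RT assoc_mult_mat[of _ ?m ?m _ ?m _ ?m])
    also have "\<dots> = R * R * M * (R * R)"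
      using Rc Mc by (simp add: BW[symmetric]) (simp add: B_def assoc_mult_mat[of _ ?m ?m _ ?m _ ?m])
    also have "\<dots> = M" using Mc by (simp add: R(2))
    finally show "M = R * W * mat_diag ?m d' * transpose_mat (R * W)" by simp
  qed
qed

section \<open>Eigenbases and quadratic forms\<close>

text \<open>An orthonormal eigenbasis in coordinates: \<open>u k\<close> is the eigenvector for the eigenvalue \<open>d k\<close>. The
first two conditions say that the square matrix of all \<open>u k i\<close> is orthogonal, the third one is the
spectral decomposition of \<open>M\<close>.\<close>

definition eigenbasis :: "nat \<Rightarrow> real mat \<Rightarrow> (nat \<Rightarrow> nat \<Rightarrow> real) \<Rightarrow> (nat \<Rightarrow> real) \<Rightarrow> bool" where
  "eigenbasis n M u d \<longleftrightarrow>
     (\<forall>k<n. \<forall>l<n. (\<Sum>i<n. u k i * u l i) = (if k = l then 1 else 0)) \<and>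
     (\<forall>i<n. \<forall>j<n. (\<Sum>k<n. u k i * u k j) = (if i = j then 1 else 0)) \<and>
     (\<forall>i<n. \<forall>j<n. M $$ (i, j) = (\<Sum>k<n. d k * u k i * u k j))"

lemma proots_linear_factors:
  "proots (\<Prod>a\<leftarrow>es. [:- a, 1 :: 'a :: idom:]) = mset es"
proof (induction es)
  case (Cons e es)
  have "(\<Prod>a\<leftarrow>es. [:- a, 1:]) \<noteq> 0" by (auto simp: prod_list_zero_iff)
  then show ?case using Cons by (simp add: proots_mult del: mult_pCons_left)
qed simp

lemma eigenbasis_exists:
  assumes M: "M \<in> Sym n"
  shows "\<exists>u d. eigenbasis n M u d \<and> phase M = (\<Sum>k<n. arctan (d k))"
proof -
  obtain U d where U: "U \<in> carrier_mat n n" "U * transpose_mat U = 1\<^sub>m n"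
      "M = U * mat_diag n d * transpose_mat U"
    using spectral_theorem[OF M] by blast
  have UTU: "transpose_mat U * U = 1\<^sub>m n"
    using mat_mult_left_right_inverse[of U n "transpose_mat U"] U by simp
  define u where "u k i = U $$ (i, k)" for k i
  have "eigenbasis n M u d"
    unfolding eigenbasis_def
  proof (intro conjI allI impI)
    fix k l assume "k < n" "l < n"
    then show "(\<Sum>i<n. u k i * u l i) = (if k = l then 1 else 0)"
      using arg_cong[OF UTU, of "\<lambda>X. X $$ (k, l)"] U(1)
      by (simp add: u_def scalar_prod_def atLeast0LessThan)
  next
    fix i j assume ij: "i < n" "j < n"
    then show "(\<Sum>k<n. u k i * u k j) = (if i = j then 1 else 0)"
      using arg_cong[OF U(2), of "\<lambda>X. X $$ (i, j)"] U(1)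
      by (simp add: u_def scalar_prod_def atLeast0LessThan)
    show "M $$ (i, j) = (\<Sum>k<n. d k * u k i * u k j)"
      using arg_cong[OF U(3), of "\<lambda>X. X $$ (i, j)"] U(1) ij
      by (simp add: mat_diag_mult_right[of U n n] u_def scalar_prod_def atLeast0LessThan mult_ac)
  qed
  moreover have "phase M = (\<Sum>k<n. arctan (d k))"
  proof -
    have "similar_mat M (mat_diag n d)"
      by (rule similar_matI[of _ _ U "transpose_mat U" n]) (use U UTU M in \<open>auto simp: Sym_def\<close>)
    then have "char_poly M = char_poly (mat_diag n d)" by (rule char_poly_similar)
    also have "\<dots> = (\<Prod>a\<leftarrow>map d [0..<n]. [:- a, 1:])"
      by (subst char_poly_upper_triangular[of _ n])
        (auto simp: mat_diag_def upper_triangular_def diag_mat_def intro!: arg_cong[of _ _ prod_list])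
    finally have "proots (char_poly M) = mset (map d [0..<n])"
      by (simp only: proots_linear_factors)
    then show ?thesis
      by (simp add: phase_def sum_unfold_sum_mset image_mset.compositionality o_def atLeast0LessThan)
  qed
  ultimately show ?thesis by blast
qed

definition quadratic_form :: "nat \<Rightarrow> real mat \<Rightarrow> (nat \<Rightarrow> real) \<Rightarrow> real" where
  "quadratic_form n M x = (\<Sum>i<n. \<Sum>j<n. M $$ (i, j) * x i * x j)"

lemma quadratic_form_eigenbasis:
  assumes "eigenbasis n M u d"
  shows "quadratic_form n M x = (\<Sum>k<n. (\<Sum>i<n. x i * u k i)\<^sup>2 * d k)"
proof -
  have "quadratic_form n M x = (\<Sum>i<n. \<Sum>j<n. \<Sum>k<n. d k * (x i * u k i) * (x j * u k j))"
    unfolding quadratic_form_def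
    by (intro sum.cong refl) (use assms in \<open>simp add: eigenbasis_def sum_distrib_right sum_distrib_left mult_ac\<close>)
  also have "\<dots> = (\<Sum>k<n. \<Sum>i<n. \<Sum>j<n. d k * (x i * u k i) * (x j * u k j))"
    by (subst sum.swap[of _ "{..<n}" "{..<n}"], subst sum.swap[of _ "{..<n}" "{..<n}"], rule refl)
  also have "\<dots> = (\<Sum>k<n. (\<Sum>i<n. x i * u k i)\<^sup>2 * d k)"
    by (simp add: power2_eq_square sum_product sum_distrib_left sum_distrib_right mult_ac)
  finally show ?thesis .
qed

lemma quadratic_form_eigenvector:
  assumes "eigenbasis n M u d" "k < n"
  shows "quadratic_form n M (u k) = d k"
proof -
  have "(\<Sum>i<n. u k i * u l i)\<^sup>2 * d l = (if l = k then d k else 0)" if "l < n" for l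
    using assms that by (simp add: eigenbasis_def)
  then show ?thesis using assms(2) by (simp add: quadratic_form_eigenbasis[OF assms(1)])
qed

lemma Parseval:
  assumes "eigenbasis n M u d"
  shows "(\<Sum>k<n. (\<Sum>i<n. x i * u k i)\<^sup>2) = (\<Sum>i<n. (x i)\<^sup>2)"
proof -
  have "eigenbasis n (1\<^sub>m n) u (\<lambda>_. 1)" using assms by (auto simp: eigenbasis_def)
  then have "(\<Sum>k<n. (\<Sum>i<n. x i * u k i)\<^sup>2) = quadratic_form n (1\<^sub>m n) x"
    by (simp add: quadratic_form_eigenbasis)
  also have "\<dots> = (\<Sum>i<n. \<Sum>j<n. if j = i then (x i)\<^sup>2 else 0)"
    unfolding quadratic_form_def by (intro sum.cong refl) (auto simp: power2_eq_square)
  finally show ?thesis by simp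
qed

text \<open>The squared coefficients of the vectors of one orthonormal basis in another form a doubly stochastic
matrix. Quadratic forms in one eigenbasis are thereby averages of the eigenvalues of the other matrix.\<close>

definition overlap :: "nat \<Rightarrow> (nat \<Rightarrow> nat \<Rightarrow> real) \<Rightarrow> (nat \<Rightarrow> nat \<Rightarrow> real) \<Rightarrow> nat \<Rightarrow> nat \<Rightarrow> real" where
  "overlap n u v k l = (\<Sum>i<n. u k i * v l i)\<^sup>2"

lemma overlap_doubly_stochastic:
  assumes "eigenbasis n M u d" "eigenbasis n N v m"
  shows "overlap n u v k l \<ge> 0"
    and "k < n \<Longrightarrow> (\<Sum>l<n. overlap n u v k l) = 1"
    and "l < n \<Longrightarrow> (\<Sum>k<n. overlap n u v k l) = 1"
proof -
  have u: "(\<Sum>i<n. (u k i)\<^sup>2) = 1" if "k < n" for k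
    using assms(1) that by (simp add: eigenbasis_def power2_eq_square)
  have v: "(\<Sum>i<n. (v k i)\<^sup>2) = 1" if "k < n" for k
    using assms(2) that by (simp add: eigenbasis_def power2_eq_square)
  show "overlap n u v k l \<ge> 0" by (simp add: overlap_def)
  show "(\<Sum>l<n. overlap n u v k l) = 1" if "k < n"
    unfolding overlap_def using Parseval[OF assms(2), of "u k"] u[OF that] by simp
  show "(\<Sum>k<n. overlap n u v k l) = 1" if "l < n"
    unfolding overlap_def using Parseval[OF assms(1), of "v l"] v[OF that] by (simp add: mult.commute)
qed

section \<open>The cotangent of the complementary phase is concave\<close>

text \<open>The phase measured down from its supremum \<open>n \<pi> / 2\<close>: the sum of the inverse cotangents of the
eigenvalues.\<close>

definition cophase :: "nat \<Rightarrow> real mat \<Rightarrow> real" where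
  "cophase n M = real n * (pi / 2) - phase M"

lemma cophase_eq:
  assumes "phase M = (\<Sum>k<n. arctan (d k))"
  shows "cophase n M = (\<Sum>k<n. coangle (d k))"
  using assms by (simp add: cophase_def coangle_def sum_subtractf)

lemma cophase_pos: 
  assumes "M \<in> Sym n" "n > 0"
  shows "cophase n M > 0"
proof -
  obtain u d where "phase M = (\<Sum>k<n. arctan (d k))" using eigenbasis_exists[OF assms(1)] by blast
  then show ?thesis using assms(2) coangle_bounds by (auto simp: cophase_eq intro!: sum_pos)
qed

text \<open>The numbers \<open>quadratic_form n M (u k)\<close> are the diagonal of \<open>M\<close> in the basis \<open>u\<close>, that is, the image
of the eigenvalues of \<open>M\<close> under a doubly stochastic matrix. The right-hand side is affine in that
matrix, so by the rearrangement inequality some permutation makes it at most as large. For a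
permutation, the inequality is the one for numbers, since reordering the eigenvalues of \<open>M\<close> leaves
\<open>cophase n M\<close> unchanged.\<close>

lemma cot_cophase_tangent:
  assumes M: "M \<in> Sym n" "cophase n M < pi" and n: "n > 0"
    and u: "eigenbasis n X u d" and y: "(\<Sum>k<n. coangle (y k)) < pi"
  shows "cot (cophase n M) \<le> cot (\<Sum>k<n. coangle (y k)) + (1 + (cot (\<Sum>k<n. coangle (y k)))\<^sup>2)
           * (\<Sum>k<n. (quadratic_form n M (u k) - y k) / (1 + (y k)\<^sup>2))"
proof -
  obtain v m where v: "eigenbasis n M v m" and ph: "phase M = (\<Sum>k<n. arctan (m k))"
    using eigenbasis_exists[OF M(1)] by blast
  obtain f where f: "bij_betw f {..<n} {..<n}" and le: "(\<Sum>k<n. 1 / (1 + (y k)\<^sup>2) * m (f k))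
      \<le> (\<Sum>k<n. \<Sum>l<n. overlap n u v k l * (1 / (1 + (y k)\<^sup>2) * m l))"
    using doubly_stochastic_rearrangement[of "{..<n}" "{..<n}" "overlap n u v" "\<lambda>k. 1 / (1 + (y k)\<^sup>2)" m]
      overlap_doubly_stochastic[OF u v] by auto
  have T: "(\<Sum>k<n. coangle (m (f k))) = cophase n M"
    unfolding cophase_eq[OF ph] by (rule sum.reindex_bij_betw[OF f])
  have "(\<Sum>k<n. m (f k) / (1 + (y k)\<^sup>2)) \<le> (\<Sum>k<n. quadratic_form n M (u k) / (1 + (y k)\<^sup>2))"
    using le by (simp add: quadratic_form_eigenbasis[OF v] overlap_def sum_divide_distrib)
  then have S: "(\<Sum>k<n. (m (f k) - y k) / (1 + (y k)\<^sup>2))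
      \<le> (\<Sum>k<n. (quadratic_form n M (u k) - y k) / (1 + (y k)\<^sup>2))"
    by (simp add: diff_divide_distrib sum_subtractf)
  have "cot (cophase n M) \<le> cot (\<Sum>k<n. coangle (y k)) + (1 + (cot (\<Sum>k<n. coangle (y k)))\<^sup>2)
           * (\<Sum>k<n. (m (f k) - y k) / (1 + (y k)\<^sup>2))"
    using cot_sum_coangle_tangent[of "{..<n}" "\<lambda>k. m (f k)" y] n M(2) y by (auto simp: T)
  also have "\<dots> \<le> cot (\<Sum>k<n. coangle (y k)) + (1 + (cot (\<Sum>k<n. coangle (y k)))\<^sup>2)
           * (\<Sum>k<n. (quadratic_form n M (u k) - y k) / (1 + (y k)\<^sup>2))"
    by (intro add_left_mono mult_left_mono S) simp
  finally show ?thesis .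
qed

lemma Sym_linear_comb:
  assumes "M \<in> Sym n" "N \<in> Sym n"
  shows "a \<cdot>\<^sub>m M + b \<cdot>\<^sub>m N \<in> Sym n"
proof -
  have "M $$ (i, j) = M $$ (j, i)" "N $$ (i, j) = N $$ (j, i)" if "i < n" "j < n" for i j
    using assms that by (auto simp: Sym_def dest: arg_cong[of _ _ "\<lambda>X. X $$ (i, j)"])
  then show ?thesis using assms by (auto simp: Sym_def intro!: eq_matI)
qed

text \<open>The tangent inequality is applied to \<open>M\<close> and \<open>N\<close> in an eigenbasis of their convex combination
\<open>X\<close>, whose eigenvalues \<open>d\<close> are the convex combinations of the two diagonals. With \<open>y = d\<close>, the linear
terms of the averaged inequality cancel, which is concavity. That \<open>d\<close> itself is admissible needs an argument.
If its angle sum were at least \<open>\<pi>\<close>, increasing all eigenvalues by the same \<open>r \<ge> 0\<close> would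
bring the sum to any given value in \<open>(0, \<pi>)\<close>, even to one whose cotangent is less than the
average of the cotangents for \<open>M\<close> and \<open>N\<close>. At this point the tangent inequality bounds the
average by that smaller number, because its linear term is at most 0.\<close>

lemma cot_cophase_concave:
  assumes M: "M \<in> Sym n" "cophase n M < pi" and N: "N \<in> Sym n" "cophase n N < pi"
    and n: "n > 0" and t: "0 \<le> t" "t \<le> 1"
  defines "X \<equiv> (1 - t) \<cdot>\<^sub>m M + t \<cdot>\<^sub>m N"
  shows "cophase n X < pi" "(1 - t) * cot (cophase n M) + t * cot (cophase n N) \<le> cot (cophase n X)"
proof -
  define c where "c = (1 - t) * cot (cophase n M) + t * cot (cophase n N)"
  have X: "X \<in> Sym n" unfolding X_def by (rule Sym_linear_comb[OF M(1) N(1)])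
  obtain u d where u: "eigenbasis n X u d" and ph: "phase X = (\<Sum>k<n. arctan (d k))"
    using eigenbasis_exists[OF X] by blast
  have d: "d k = (1 - t) * quadratic_form n M (u k) + t * quadratic_form n N (u k)" if "k < n" for k
  proof -
    have "d k = quadratic_form n X (u k)" using quadratic_form_eigenvector[OF u that] by simp
    also have "\<dots> = (1 - t) * quadratic_form n M (u k) + t * quadratic_form n N (u k)"
      unfolding quadratic_form_def sum_distrib_left sum.distrib[symmetric]
      by (intro sum.cong refl) (use M(1) N(1) in \<open>auto simp: X_def Sym_def algebra_simps\<close>)
    finally show ?thesis .
  qed
  \<comment> \<open>the average of the tangent inequalities for M and N\<close>
  have key: "c \<le> cot Y + (1 + (cot Y)\<^sup>2) * (\<Sum>k<n. (d k - y k) / (1 + (y k)\<^sup>2))"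
    if Y: "Y = (\<Sum>k<n. coangle (y k))" "Y < pi" for y Y
  proof -
    have "c \<le> (1 - t) * (cot Y + (1 + (cot Y)\<^sup>2) * (\<Sum>k<n. (quadratic_form n M (u k) - y k) / (1 + (y k)\<^sup>2)))
        + t * (cot Y + (1 + (cot Y)\<^sup>2) * (\<Sum>k<n. (quadratic_form n N (u k) - y k) / (1 + (y k)\<^sup>2)))"
      unfolding c_def using t cot_cophase_tangent[OF M n u, of y] cot_cophase_tangent[OF N n u, of y] Y
      by (intro add_mono mult_left_mono) auto
    also have "\<dots> = cot Y + (1 + (cot Y)\<^sup>2) * ((1 - t) * (\<Sum>k<n. (quadratic_form n M (u k) - y k) / (1 + (y k)\<^sup>2))
        + t * (\<Sum>k<n. (quadratic_form n N (u k) - y k) / (1 + (y k)\<^sup>2)))"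
      by (simp add: algebra_simps)
    also have "(1 - t) * (\<Sum>k<n. (quadratic_form n M (u k) - y k) / (1 + (y k)\<^sup>2))
        + t * (\<Sum>k<n. (quadratic_form n N (u k) - y k) / (1 + (y k)\<^sup>2)) = (\<Sum>k<n. (d k - y k) / (1 + (y k)\<^sup>2))"
      unfolding sum_distrib_left sum.distrib[symmetric]
    proof (intro sum.cong refl)
      fix k assume "k \<in> {..<n}"
      then have "d k - y k = (1 - t) * (quadratic_form n M (u k) - y k) + t * (quadratic_form n N (u k) - y k)"
        by (simp add: d algebra_simps)
      then show "(1 - t) * ((quadratic_form n M (u k) - y k) / (1 + (y k)\<^sup>2))
          + t * ((quadratic_form n N (u k) - y k) / (1 + (y k)\<^sup>2)) = (d k - y k) / (1 + (y k)\<^sup>2)"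
        by (simp add: add_divide_distrib)
    qed
    finally show ?thesis .
  qed
  have T: "cophase n X = (\<Sum>k<n. coangle (d k))" by (rule cophase_eq[OF ph])
  show lt: "cophase n X < pi"
  proof (rule ccontr)
    assume "\<not> cophase n X < pi"
    define g where "g r = (\<Sum>k<n. coangle (d k + r))" for r
    define \<tau> where "\<tau> = coangle (c - 1)"
    have \<tau>: "0 < \<tau>" "\<tau> < pi" "cot \<tau> = c - 1" using coangle_bounds by (auto simp: \<tau>_def)
    have "((\<lambda>r. coangle (d k + r)) \<longlongrightarrow> pi / 2 - pi / 2) at_top" for k
      unfolding coangle_def
      by (intro tendsto_diff tendsto_const filterlim_compose[OF tendsto_arctan_at_top]
          filterlim_tendsto_add_at_top[OF tendsto_const] filterlim_ident)
    then have "(g \<longlongrightarrow> (\<Sum>k<n. pi / 2 - pi / 2)) at_top"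
      unfolding g_def by (intro tendsto_sum)
    then have "(g \<longlongrightarrow> 0) at_top" by simp
    then have "eventually (\<lambda>r. g r < \<tau> \<and> 0 \<le> r) at_top"
      using \<tau> by (intro eventually_conj order_tendstoD eventually_ge_at_top)
    then obtain r0 where r0: "g r0 < \<tau>" "0 \<le> r0" by (auto simp: eventually_at_top_linorder)
    have "\<exists>r\<ge>0. r \<le> r0 \<and> g r = \<tau>"
    proof (rule IVT2')
      show "\<tau> \<le> g 0" using \<open>\<not> cophase n X < pi\<close> \<tau> by (simp add: g_def T)
      show "continuous_on {0..r0} g"
        unfolding g_def coangle_def by (intro continuous_intros)
    qed (use r0 in auto)
    then obtain r where r: "r \<ge> 0" "g r = \<tau>" by blast
    have "c \<le> cot \<tau> + (1 + (cot \<tau>)\<^sup>2) * (\<Sum>k<n. (d k - (d k + r)) / (1 + (d k + r)\<^sup>2))"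
      using r \<tau> by (intro key) (auto simp: g_def)
    moreover have "(1 + (cot \<tau>)\<^sup>2) * (\<Sum>k<n. (d k - (d k + r)) / (1 + (d k + r)\<^sup>2)) \<le> 0"
      using r(1) by (intro mult_nonneg_nonpos sum_nonpos divide_nonpos_nonneg) auto
    ultimately show False using \<tau>(3) by simp
  qed
  show "(1 - t) * cot (cophase n M) + t * cot (cophase n N) \<le> cot (cophase n X)"
    using key[of _ d, OF T lt] by (simp add: c_def T)
qed

section \<open>Concavity of the exponential of the phase\<close>

text \<open>The second derivative is \<open>A (A + 2 y) exp (- A arctan y) / (1 + y\<^sup>2)\<^sup>2\<close>; its sign is where the size of
\<open>A\<close> matters.\<close>

lemma exp_arctan_convex:
  fixes A :: real
  assumes "A \<ge> 0"
  shows "convex_on {- A / 2..} (\<lambda>y. exp (- A * arctan y))"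
proof (rule f''_ge0_imp_convex)
  fix y :: real assume y: "y \<in> {- A / 2..}"
  show "((\<lambda>y. exp (- A * arctan y)) has_real_derivative - A * (exp (- A * arctan y) / (1 + y\<^sup>2))) (at y)"
    by (auto intro!: derivative_eq_intros simp: divide_inverse)
  have nz: "1 + y\<^sup>2 > 0" by (auto intro: add_pos_nonneg)
  show "((\<lambda>y. - A * (exp (- A * arctan y) / (1 + y\<^sup>2))) has_real_derivative
      A * (A + 2 * y) * exp (- A * arctan y) / (1 + y\<^sup>2)\<^sup>2) (at y)"
    using nz by (auto intro!: derivative_eq_intros simp: divide_simps power2_eq_square) (auto simp: algebra_simps)
  show "0 \<le> A * (A + 2 * y) * exp (- A * arctan y) / (1 + y\<^sup>2)\<^sup>2"
    using y assms by simp
qed auto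

lemma arctan_cot:
  assumes "0 < T" "T < pi"
  shows "arctan (cot T) = pi / 2 - T"
  using assms arctan_tan[of "pi / 2 - T"] by (simp add: tan_cot')

lemma cot_le_cot_iff:
  assumes "0 < S" "S < pi" "0 < T" "T < pi"
  shows "cot S \<le> cot T \<longleftrightarrow> T \<le> S"
  using arctan_le_iff[of "cot S" "cot T"] assms by (simp add: arctan_cot)

text \<open>On matrices with \<open>cophase n Z < \<pi>\<close>, the phase is \<open>(n - 1) \<pi> / 2 + arctan (cot (cophase n Z))\<close>. Thus
\<open>exp (- A * phase Z)\<close> is, up to a constant factor, a convex and decreasing function of the concave
quantity \<open>cot (cophase n Z)\<close>, and convexity passes to the composition. The domain \<open>cophase n Z \<le> \<beta>\<close>
is the superlevel set \<open>cot (cophase n Z) \<ge> cot \<beta>\<close> of the same concave quantity.\<close>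

lemma exp_phase_concave:
  assumes n: "n > 0" and A: "A \<ge> 0" and \<beta>: "\<beta> < pi" "- A / 2 \<le> cot \<beta>"
    and M: "M \<in> Sym n" "cophase n M \<le> \<beta>" and N: "N \<in> Sym n" "cophase n N \<le> \<beta>"
    and t: "0 \<le> t" "t \<le> 1"
  defines "X \<equiv> (1 - t) \<cdot>\<^sub>m M + t \<cdot>\<^sub>m N"
  shows "cophase n X \<le> \<beta>"
    and "exp (- A * phase X) \<le> (1 - t) * exp (- A * phase M) + t * exp (- A * phase N)"
proof -
  define h where "h y = exp (- A * arctan y)" for y
  define K where "K = exp (- A * ((real n - 1) * (pi / 2)))"
  have X: "X \<in> Sym n" unfolding X_def by (rule Sym_linear_comb[OF M(1) N(1)])
  have \<beta>0: "0 < \<beta>" using cophase_pos[OF M(1) n] M(2) by linarith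
  have conc: "cophase n X < pi" "(1 - t) * cot (cophase n M) + t * cot (cophase n N) \<le> cot (cophase n X)"
    using cot_cophase_concave[OF M(1) _ N(1) _ n t] M(2) N(2) \<beta>(1) by (auto simp: X_def)
  have ge: "cot \<beta> \<le> cot (cophase n Z)" if "Z \<in> Sym n" "cophase n Z \<le> \<beta>" for Z
    using that cophase_pos[OF that(1) n] \<beta>(1) \<beta>0 by (simp add: cot_le_cot_iff)
  have exp_phase: "exp (- A * phase Z) = K * h (cot (cophase n Z))" if "Z \<in> Sym n" "cophase n Z < pi" for Z
  proof -
    have "phase Z = (real n - 1) * (pi / 2) + arctan (cot (cophase n Z))"
      unfolding arctan_cot[OF cophase_pos[OF that(1) n] that(2)] by (simp add: cophase_def field_simps)
    then show ?thesis by (simp add: K_def h_def exp_add[symmetric] algebra_simps)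
  qed
  let ?y = "(1 - t) * cot (cophase n M) + t * cot (cophase n N)"
  have "cot \<beta> = (1 - t) * cot \<beta> + t * cot \<beta>" by (simp add: algebra_simps)
  also have "\<dots> \<le> ?y" using ge M N t by (intro add_mono mult_left_mono) auto
  finally have "cot \<beta> \<le> ?y" .
  then show "cophase n X \<le> \<beta>"
    using cot_le_cot_iff[of \<beta> "cophase n X"] conc \<beta>(1) \<beta>0 cophase_pos[OF X n] by auto
  have "h (cot (cophase n X)) \<le> h ?y"
    unfolding h_def using conc(2) A by (simp add: mult_left_mono arctan_le_iff)
  also have "\<dots> \<le> (1 - t) * h (cot (cophase n M)) + t * h (cot (cophase n N))"
    using convex_onD[OF exp_arctan_convex[OF A], of t "cot (cophase n M)" "cot (cophase n N)"]
      ge[OF M] ge[OF N] \<beta>(2) t by (simp add: h_def)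
  finally have "K * h (cot (cophase n X)) \<le> K * ((1 - t) * h (cot (cophase n M)) + t * h (cot (cophase n N)))"
    by (rule mult_left_mono) (simp add: K_def)
  then show "exp (- A * phase X) \<le> (1 - t) * exp (- A * phase M) + t * exp (- A * phase N)"
    using exp_phase[OF X conc(1)] exp_phase[OF M(1)] exp_phase[OF N(1)] M(2) N(2) \<beta>(1)
    by (simp add: algebra_simps)
qed

section \<open>The derivative of the phase\<close>

lemma arctan_linearization_error:
  "\<bar>arctan b - arctan a - (b - a) / (1 + a\<^sup>2)\<bar> \<le> (b - a)\<^sup>2"
proof -
  have lip: "\<bar>1 / (1 + x\<^sup>2) - 1 / (1 + y\<^sup>2)\<bar> \<le> \<bar>x - y\<bar>" for x y :: real
  proof -
    have pos: "1 + x\<^sup>2 > 0" "1 + y\<^sup>2 > 0" by (auto intro: add_pos_nonneg)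
    have half: "2 * \<bar>z\<bar> \<le> 1 + z\<^sup>2" for z :: real
      using zero_le_power2[of "\<bar>z\<bar> - 1"] by (simp add: power2_diff)
    have "\<bar>x + y\<bar> \<le> \<bar>x\<bar> + \<bar>y\<bar>" by simp
    also have "\<dots> \<le> 1 + x\<^sup>2 + y\<^sup>2" using half[of x] half[of y] by (smt (verit) zero_le_power2)
    also have "\<dots> \<le> (1 + x\<^sup>2) * (1 + y\<^sup>2)" by (simp add: algebra_simps)
    finally have le: "\<bar>x + y\<bar> / ((1 + x\<^sup>2) * (1 + y\<^sup>2)) \<le> 1" using pos by (simp add: pos_divide_le_eq)
    have "1 / (1 + x\<^sup>2) - 1 / (1 + y\<^sup>2) = (y - x) * ((x + y) / ((1 + x\<^sup>2) * (1 + y\<^sup>2)))"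
      using pos by (simp add: divide_simps) (simp add: power2_eq_square algebra_simps)
    then have "\<bar>1 / (1 + x\<^sup>2) - 1 / (1 + y\<^sup>2)\<bar> = \<bar>x - y\<bar> * (\<bar>x + y\<bar> / ((1 + x\<^sup>2) * (1 + y\<^sup>2)))"
      using pos by (simp add: abs_mult abs_minus_commute)
    then show ?thesis using mult_left_mono[OF le, of "\<bar>x - y\<bar>"] by simp
  qed
  have der: "(arctan has_real_derivative 1 / (1 + x\<^sup>2)) (at x)" for x
    using DERIV_arctan[of x] by (simp add: inverse_eq_divide)
  obtain z where z: "\<bar>z - a\<bar> \<le> \<bar>b - a\<bar>" "arctan b - arctan a = (b - a) * (1 / (1 + z\<^sup>2))"
  proof (cases a b rule: linorder_cases)
    case less
    obtain z where "a < z" "z < b" "arctan b - arctan a = (b - a) * (1 / (1 + z\<^sup>2))"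
      using MVT2[OF less der] by blast
    then show ?thesis using that[of z] by auto
  next
    case greater
    obtain z where "b < z" "z < a" "arctan a - arctan b = (a - b) * (1 / (1 + z\<^sup>2))"
      using MVT2[OF greater der] by blast
    then have "arctan b - arctan a = - ((a - b) * (1 / (1 + z\<^sup>2)))" by linarith
    also have "\<dots> = (b - a) * (1 / (1 + z\<^sup>2))" by (simp only: mult_minus_left[symmetric] minus_diff_eq)
    finally show ?thesis using that[of z] \<open>b < z\<close> \<open>z < a\<close> by simp
  qed (use that in auto)
  have "\<bar>arctan b - arctan a - (b - a) / (1 + a\<^sup>2)\<bar> = \<bar>b - a\<bar> * \<bar>1 / (1 + z\<^sup>2) - 1 / (1 + a\<^sup>2)\<bar>"
    unfolding z(2) abs_mult[symmetric] by (simp add: right_diff_distrib)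
  also have "\<dots> \<le> \<bar>b - a\<bar> * \<bar>b - a\<bar>"
    using lip[of z a] z(1) by (intro mult_left_mono) auto
  finally show ?thesis by (simp add: power2_eq_square)
qed

lemma inner_eigenbasis:
  assumes "eigenbasis n M u d"
  shows "(\<Sum>i<n. \<Sum>j<n. M $$ (i, j) * N $$ (i, j)) = (\<Sum>k<n. d k * quadratic_form n N (u k))"
proof -
  have "(\<Sum>i<n. \<Sum>j<n. M $$ (i, j) * N $$ (i, j))
      = (\<Sum>i<n. \<Sum>j<n. \<Sum>k<n. d k * (N $$ (i, j) * u k i * u k j))"
    by (intro sum.cong refl) (use assms in \<open>simp add: eigenbasis_def sum_distrib_left sum_distrib_right mult_ac\<close>)
  also have "\<dots> = (\<Sum>k<n. \<Sum>i<n. \<Sum>j<n. d k * (N $$ (i, j) * u k i * u k j))"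
    by (subst sum.swap[of _ "{..<n}" "{..<n}"], subst sum.swap[of _ "{..<n}" "{..<n}"], rule refl)
  finally show ?thesis by (simp add: quadratic_form_def sum_distrib_left)
qed

lemma inner_overlap:
  assumes "eigenbasis n M u d" "eigenbasis n N v m"
  shows "(\<Sum>i<n. \<Sum>j<n. M $$ (i, j) * N $$ (i, j)) = (\<Sum>k<n. \<Sum>l<n. overlap n u v k l * (d k * m l))"
  by (simp add: inner_eigenbasis[OF assms(1)] quadratic_form_eigenbasis[OF assms(2)] overlap_def
      sum_distrib_left mult_ac)

lemma sum_overlap:
  assumes "eigenbasis n M u d" "eigenbasis n N v m"
  shows "(\<Sum>k<n. \<Sum>l<n. overlap n u v k l * f k) = (\<Sum>k<n. f k)"
    and "(\<Sum>k<n. \<Sum>l<n. overlap n u v k l * g l) = (\<Sum>l<n. g l)"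
proof -
  show "(\<Sum>k<n. \<Sum>l<n. overlap n u v k l * f k) = (\<Sum>k<n. f k)"
    by (simp add: overlap_doubly_stochastic[OF assms] flip: sum_distrib_right)
  show "(\<Sum>k<n. \<Sum>l<n. overlap n u v k l * g l) = (\<Sum>l<n. g l)"
    by (subst sum.swap) (simp add: overlap_doubly_stochastic[OF assms] flip: sum_distrib_right)
qed

lemma inner_self_eigenbasis:
  assumes "eigenbasis n M u d"
  shows "(\<Sum>i<n. \<Sum>j<n. M $$ (i, j) * M $$ (i, j)) = (\<Sum>k<n. (d k)\<^sup>2)"
  using quadratic_form_eigenvector[OF assms] by (simp add: inner_eigenbasis[OF assms] power2_eq_square)

text \<open>Here \<open>W\<close> is the inverse of \<open>1 + M\<^sup>2\<close>. With the overlaps \<open>P k l\<close> of the eigenbases of \<open>M\<close> and \<open>N\<close>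
as weights, the error of the linearization of the trace is the weighted sum of the errors of the
scalar linearizations \<open>e k l\<close> of arctan at \<open>d k\<close>, evaluated at \<open>m l\<close>. Each is at most
\<open>(m l - d k)\<^sup>2\<close>, and the weighted sum of these squares is the squared Frobenius norm of \<open>N - M\<close>.
In this way the phase is differentiated without following eigenvalues along a path of matrices.\<close>

lemma phase_linearization_error:
  assumes M: "eigenbasis n M u d" "phase M = (\<Sum>k<n. arctan (d k))"
    and W: "eigenbasis n W u (\<lambda>k. 1 / (1 + (d k)\<^sup>2))" and N: "N \<in> Sym n"
  shows "\<bar>phase N - phase M - (\<Sum>i<n. \<Sum>j<n. W $$ (i, j) * (N $$ (i, j) - M $$ (i, j)))\<bar>
      \<le> (\<Sum>i<n. \<Sum>j<n. (N $$ (i, j) - M $$ (i, j))\<^sup>2)"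
proof -
  obtain v m where v: "eigenbasis n N v m" and ph: "phase N = (\<Sum>k<n. arctan (m k))"
    using eigenbasis_exists[OF N] by blast
  let ?P = "overlap n u v"
  define e where "e k l = arctan (m l) - arctan (d k) - (m l - d k) / (1 + (d k)\<^sup>2)" for k l
  have WM: "(\<Sum>i<n. \<Sum>j<n. W $$ (i, j) * M $$ (i, j)) = (\<Sum>k<n. d k / (1 + (d k)\<^sup>2))"
    using quadratic_form_eigenvector[OF M(1)] by (simp add: inner_eigenbasis[OF W])
  have WN: "(\<Sum>i<n. \<Sum>j<n. W $$ (i, j) * N $$ (i, j)) = (\<Sum>k<n. \<Sum>l<n. ?P k l * (m l / (1 + (d k)\<^sup>2)))"
    by (simp add: inner_overlap[OF W v])
  have "(\<Sum>k<n. \<Sum>l<n. ?P k l * e k l) = phase N - phase M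
      - (\<Sum>k<n. \<Sum>l<n. ?P k l * (m l / (1 + (d k)\<^sup>2))) + (\<Sum>k<n. d k / (1 + (d k)\<^sup>2))"
    unfolding ph M(2) sum_overlap(1)[OF M(1) v, of "\<lambda>k. arctan (d k)", symmetric]
      sum_overlap(1)[OF M(1) v, of "\<lambda>k. d k / (1 + (d k)\<^sup>2)", symmetric]
      sum_overlap(2)[OF M(1) v, of "\<lambda>l. arctan (m l)", symmetric]
      sum.distrib[symmetric] sum_subtractf[symmetric] e_def
    by (intro sum.cong refl) (simp add: algebra_simps diff_divide_distrib)
  then have eq: "phase N - phase M - (\<Sum>i<n. \<Sum>j<n. W $$ (i, j) * (N $$ (i, j) - M $$ (i, j)))
      = (\<Sum>k<n. \<Sum>l<n. ?P k l * e k l)"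
    by (simp add: right_diff_distrib sum_subtractf WM WN)
  have "\<bar>\<Sum>k<n. \<Sum>l<n. ?P k l * e k l\<bar> \<le> (\<Sum>k<n. \<Sum>l<n. ?P k l * (m l - d k)\<^sup>2)"
  proof (intro order_trans[OF sum_abs] sum_mono)
    fix k l
    show "\<bar>?P k l * e k l\<bar> \<le> ?P k l * (m l - d k)\<^sup>2"
      using arctan_linearization_error[of "m l" "d k"]
      by (simp add: abs_mult e_def overlap_def mult_left_mono)
  qed
  also have "\<dots> = (\<Sum>l<n. (m l)\<^sup>2) - 2 * (\<Sum>k<n. \<Sum>l<n. ?P k l * (d k * m l)) + (\<Sum>k<n. (d k)\<^sup>2)"
    unfolding sum_overlap(1)[OF M(1) v, of "\<lambda>k. (d k)\<^sup>2", symmetric]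
      sum_overlap(2)[OF M(1) v, of "\<lambda>l. (m l)\<^sup>2", symmetric]
      sum_distrib_left sum.distrib[symmetric] sum_subtractf[symmetric]
    by (intro sum.cong refl) (simp add: power2_diff algebra_simps)
  also have "\<dots> = (\<Sum>i<n. \<Sum>j<n. (N $$ (i, j) - M $$ (i, j))\<^sup>2)"
    unfolding inner_overlap[OF M(1) v, symmetric] inner_self_eigenbasis[OF M(1), symmetric]
      inner_self_eigenbasis[OF v, symmetric]
      sum_distrib_left sum.distrib[symmetric] sum_subtractf[symmetric]
    by (intro sum.cong refl) (simp add: power2_eq_square algebra_simps)
  finally show ?thesis unfolding eq .
qed

lemma has_real_derivative_quadratic_error:
  fixes f :: "real \<Rightarrow> real"
  assumes "\<And>t. \<bar>f t - f 0 - t * D\<bar> \<le> K * t\<^sup>2"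
  shows "(f has_real_derivative D) (at 0)"
proof -
  have "\<forall>\<^sub>F t in at 0. norm ((f t - f 0) / t - D) \<le> norm t * K"
  proof (rule eventually_at_topological[THEN iffD2], intro exI[of _ UNIV] conjI ballI impI)
    fix t :: real assume t: "t \<noteq> 0"
    have "norm ((f t - f 0) / t - D) = \<bar>f t - f 0 - t * D\<bar> / \<bar>t\<bar>"
      using t by (simp add: field_simps flip: abs_divide)
    also have "\<dots> \<le> K * t\<^sup>2 / \<bar>t\<bar>" using assms[of t] by (intro divide_right_mono) auto
    also have "\<dots> = norm t * K" using t by (simp add: power2_eq_square field_simps flip: abs_mult)
    finally show "norm ((f t - f 0) / t - D) \<le> norm t * K" .
  qed auto
  then have "((\<lambda>t. (f t - f 0) / t - D) \<longlongrightarrow> 0) (at 0)"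
    by (rule tendsto_0_le[OF tendsto_ident_at])
  then show ?thesis by (simp add: DERIV_def LIM_zero_iff)
qed

text \<open>The matrix of derivatives is \<open>A exp (- A * phase M)\<close> times the inverse of \<open>1 + M\<^sup>2\<close>, whose
eigenvalues are positive.\<close>

lemma exp_phase_elliptic:
  assumes A: "A > 0" and M: "M \<in> Sym n"
  shows "\<exists>P. has_derivative_matrix n (\<lambda>M. - exp (- A * phase M)) P M \<and> positive_definite n P"
proof -
  have Mc: "M \<in> carrier_mat n n" using M by (simp add: Sym_def)
  obtain u d where u: "eigenbasis n M u d" and ph: "phase M = (\<Sum>k<n. arctan (d k))"
    using eigenbasis_exists[OF M] by blast
  define w where "w k = 1 / (1 + (d k)\<^sup>2)" for k
  have w: "w k > 0" for k unfolding w_def by (auto intro: divide_pos_pos add_pos_nonneg)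
  define W where "W = mat n n (\<lambda>(i, j). \<Sum>k<n. w k * u k i * u k j)"
  have W: "eigenbasis n W u w" using u by (simp add: eigenbasis_def W_def)
  have WS: "W \<in> Sym n" by (auto simp: Sym_def W_def mult_ac intro!: eq_matI)
  define c where "c = A * exp (- A * phase M)"
  have c: "c > 0" using A by (simp add: c_def)
  have Wc: "W \<in> carrier_mat n n" using WS by (simp add: Sym_def)
  have PS: "c \<cdot>\<^sub>m W \<in> Sym n" by (auto simp: Sym_def W_def mult_ac intro!: eq_matI)
  have "has_derivative_matrix n (\<lambda>M. - exp (- A * phase M)) (c \<cdot>\<^sub>m W) M"
    unfolding has_derivative_matrix_def
  proof (intro conjI ballI PS)
    fix H assume H: "H \<in> Sym n"
    have Hc: "H \<in> carrier_mat n n" using H by (simp add: Sym_def)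
    define D where "D = (\<Sum>i<n. \<Sum>j<n. W $$ (i, j) * H $$ (i, j))"
    have M1: "1 \<cdot>\<^sub>m M = M" by (auto intro!: eq_matI)
    have M0: "M + 0 \<cdot>\<^sub>m H = M" using Mc Hc by (auto intro!: eq_matI)
    have "((\<lambda>t. phase (M + t \<cdot>\<^sub>m H)) has_real_derivative D) (at 0)"
    proof (rule has_real_derivative_quadratic_error)
      fix t
      have S: "M + t \<cdot>\<^sub>m H \<in> Sym n"
        using Sym_linear_comb[OF M H, of 1 t] by (simp add: M1)
      have "(M + t \<cdot>\<^sub>m H) $$ (i, j) - M $$ (i, j) = t * H $$ (i, j)" if "i < n" "j < n" for i j
        using that Mc Hc by simp
      then show "\<bar>phase (M + t \<cdot>\<^sub>m H) - phase (M + 0 \<cdot>\<^sub>m H) - t * D\<bar>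
          \<le> (\<Sum>i<n. \<Sum>j<n. (H $$ (i, j))\<^sup>2) * t\<^sup>2"
        using phase_linearization_error[OF u ph W[unfolded w_def] S]
        by (simp add: M0 D_def sum_distrib_left sum_distrib_right power_mult_distrib mult_ac)
    qed
    then have "((\<lambda>t. - exp (- A * phase (M + t \<cdot>\<^sub>m H))) has_real_derivative c * D) (at 0)"
      by (auto intro!: derivative_eq_intros simp: c_def M0)
    also have "c * D = (\<Sum>i<n. \<Sum>j<n. (c \<cdot>\<^sub>m W) $$ (i, j) * H $$ (i, j))"
      using Wc by (simp add: D_def sum_distrib_left mult.assoc)
    finally show "((\<lambda>t. - exp (- A * phase (M + t \<cdot>\<^sub>m H))) has_real_derivative
        (\<Sum>i<n. \<Sum>j<n. (c \<cdot>\<^sub>m W) $$ (i, j) * H $$ (i, j))) (at 0)" .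
  qed
  moreover have "positive_definite n (c \<cdot>\<^sub>m W)"
    unfolding positive_definite_def
  proof (intro conjI ballI impI PS)
    fix x :: "real vec" assume x: "x \<in> carrier_vec n" "x \<noteq> 0\<^sub>v n"
    have "x \<bullet> ((c \<cdot>\<^sub>m W) *\<^sub>v x) = c * quadratic_form n W (\<lambda>i. x $ i)"
      using x Wc by (simp add: scalar_prod_def quadratic_form_def sum_distrib_left atLeast0LessThan mult_ac)
    moreover have "quadratic_form n W (\<lambda>i. x $ i) > 0"
    proof -
      obtain i where i: "i < n" "x $ i \<noteq> 0" using x by (auto simp: vec_eq_iff)
      have "(\<Sum>k<n. (\<Sum>i<n. x $ i * u k i)\<^sup>2) \<noteq> 0"
        unfolding Parseval[OF u] using i by (auto simp: sum_nonneg_eq_0_iff)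
      then obtain k where k: "k < n" "(\<Sum>i<n. x $ i * u k i)\<^sup>2 \<noteq> 0"
        by (metis (no_types, lifting) lessThan_iff sum.neutral)
      then show ?thesis
        unfolding quadratic_form_eigenbasis[OF W] using w
        by (intro sum_pos2[of _ k]) (auto simp: less_imp_le)
    qed
    ultimately show "x \<bullet> ((c \<cdot>\<^sub>m W) *\<^sub>v x) > 0" using c by simp
  qed
  ultimately show ?thesis by blast
qed

section \<open>Ellipticity and concavity on superlevel sets\<close>

theorem corollary2p3:
  fixes \<delta> :: real
  assumes "\<delta> > 0"
  shows "\<exists>A::real. \<forall>n\<ge>1.
           elliptic_on n (phase_superlevel n \<delta>) (\<lambda>M. - exp (- A * phase M)) \<and>
           mat_concave_on (phase_superlevel n \<delta>) (\<lambda>M. - exp (- A * phase M))"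
proof (intro exI allI impI conjI)
  \<comment> \<open>twice the absolute value makes exp (- A * arctan y) convex for y at least - cot \<delta>;
    the summand 1 makes A positive, as ellipticity requires\<close>
  define A where "A = 2 * \<bar>cot \<delta>\<bar> + 1"
  have A: "A > 0" by (simp add: A_def)
  fix n :: nat assume "n \<ge> 1"
  then have n: "n > 0" by simp
  have \<Gamma>: "M \<in> phase_superlevel n \<delta> \<longleftrightarrow> M \<in> Sym n \<and> cophase n M \<le> pi - \<delta>" for M
    by (auto simp: phase_superlevel_def cophase_def algebra_simps)
  show "elliptic_on n (phase_superlevel n \<delta>) (\<lambda>M. - exp (- A * phase M))"
    using exp_phase_elliptic[OF A] by (auto simp: elliptic_on_def \<Gamma>)
  show "mat_concave_on (phase_superlevel n \<delta>) (\<lambda>M. - exp (- A * phase M))"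
    unfolding mat_concave_on_def
  proof (intro ballI)
    fix M N and t :: real
    assume MN: "M \<in> phase_superlevel n \<delta>" "N \<in> phase_superlevel n \<delta>" and t: "t \<in> {0..1}"
    have "cot (pi - \<delta>) = - cot \<delta>" by (simp add: cot_def)
    then have "- A / 2 \<le> cot (pi - \<delta>)" by (simp add: A_def)
    then have "cophase n ((1 - t) \<cdot>\<^sub>m M + t \<cdot>\<^sub>m N) \<le> pi - \<delta>"
      "exp (- A * phase ((1 - t) \<cdot>\<^sub>m M + t \<cdot>\<^sub>m N)) \<le> (1 - t) * exp (- A * phase M) + t * exp (- A * phase N)"
      using exp_phase_concave[of n A "pi - \<delta>" M N t] n A assms MN t by (auto simp: \<Gamma>)
    then show "(1 - t) \<cdot>\<^sub>m M + t \<cdot>\<^sub>m N \<in> phase_superlevel n \<delta> \<and>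
        (1 - t) * - exp (- A * phase M) + t * - exp (- A * phase N) \<le> - exp (- A * phase ((1 - t) \<cdot>\<^sub>m M + t \<cdot>\<^sub>m N))"
      using MN Sym_linear_comb[of M n N "1 - t" t] by (simp add: \<Gamma>)
  qed
qed

end
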